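(* Let $z^*=(x^*,y^* )\in F$ and $\Gamma^*:=\mathrm{supp}(z^* )$. Then $z^*$ is an M-stationary point of the problem $\min\{f(z):z\in F\}$ if and only if $$\nabla_if(z^* )=0\quad\forall i\in\Gamma^*\setminus\{\gamma_{x^*}\}.$$
   Context: $l,m,n,s,t$ are positive integers with $s<m$, $t<n$; $\mathscr{A}=(a_{ijk})\in\mathbb{R}^{l\times m\times n}$ and $b\in\mathbb{R}^l$ are given. For $x\in\mathbb{R}^m$, $y\in\mathbb{R}^n$, $(\mathscr{A}xy)_i=\sum_{j,k}a_{ijk}x_jy_k$, and $f(z)=f(x,y)=\frac12\|\mathscr{A}xy-b\|^2$ for $z=(x,y)\in\mathbb{R}^{m+n}$; $\nabla_if$ is the $i$-th component of $\nabla f$. $\mathrm{supp}$ is the set of indices of nonzero entries, $\|\cdot\|_0$ the number of nonzero entries. For $x\ne0$, $\gamma_x$ is the index of the first nonzero entry of $x$. $F_1=\{x\in\mathbb{R}^m:\|x\|_0\le s,\ e_{\gamma_x}^\top x=1\}$ (nonzero vectors with at most $s$ nonzero entries and first nonzero entry equal to $1$), $F_2=\{y\in\mathbb{R}^n:\|y\|_0\le t\}$, $F=F_1\times F_2$. $E:=\{z=(x,y)\in(\mathbb{R}^m\setminus\{0\})\times\mathbb{R}^n:\ x_{\gamma_x}=1\}$. $\bar F$ is the set of pairs $(z,w)$ with $z\in E$, $w=(u,v)\in\mathbb{R}^m\times\mathbb{R}^n$, $z^\top w=0$, $\sum_{i}u_i\ge m-s$, $\sum_jv_j\ge n-t$,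 and $0\le w_i\le1$ for all $i\in\{1,\dots,m+n\}$. Cones, for nonempty $S\subseteq\mathbb{R}^p$ and $x\in S$: $T^B_S(x)$ is the set of $d$ for which there exist $\{x^k\}\subset S$, $x^k\to x$, $\lambda_k\ge0$ with $\lambda_k(x^k-x)\to d$; $T^C_S(x)$ is the set of all $d$ such that for any $\{x^k\}\subset S$ with $x^k\to x$ and any $\{\lambda_k\}\subset\mathbb{R}_+$ with $\lambda_k\to0$, there exists $y^k\to d$ with $x^k+\lambda_ky^k\in S$ for all $k$; $N^\#_S(x)=\{d:\langle d,u\rangle\le0\ \forall u\in T^\#_S(x)\}$ for $\#\in\{B,C\}$. M-stationarity: $z^*$ is an M-stationary point if there exist $w^*\in\mathbb{R}^{m+n}$ with $(z^*,w^* )\in\bar F$ and $\mu\in\mathbb{R}^{m+n}$ such that $-\nabla f(z^* )-\mu\in N^\#_E(z^* )$, and $\mu_i=0$ whenever $z_i^*\ne0$. Here $\#\in\{B,C\}$ (the statement is asserted for either choice). *)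

theory Defs
  imports "HOL-Analysis.Analysis"
begin

text \<open>
  The dimensions l, m, n are the cardinalities of the finite index types 'l, 'm, 'n; the
  index type 'm is linearly ordered so that the first nonzero entry of a vector is defined.
  A point z = (x, y) of R^(m+n) is a pair of type (real^'m) \<times> (real^'n), whose inner product
  and norm in the library are the Euclidean ones; its m + n coordinates are indexed by 'm + 'n.
\<close>

definition coord :: "(real^'m) \<times> (real^'n) \<Rightarrow> 'm + 'n \<Rightarrow> real" where
  "coord z i = (case i of Inl j \<Rightarrow> fst z $ j | Inr k \<Rightarrow> snd z $ k)"

definition supp :: "real^'i \<Rightarrow> 'i set" where
  "supp x = {i. x $ i \<noteq> 0}"

definition pair_supp :: "(real^'m) \<times> (real^'n) \<Rightarrow> ('m + 'n) set" where
  "pair_supp z = {i. coord z i \<noteq> 0}"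

definition norm0 :: "real^'i \<Rightarrow> nat" where
  "norm0 x = card (supp x)"

text \<open>Only meaningful for nonzero vectors.\<close>
definition first_nz :: "real^('m::{finite,linorder}) \<Rightarrow> 'm" where
  "first_nz x = Min (supp x)"

definition tensor_app :: "real^'n^'m^'l \<Rightarrow> real^'m \<Rightarrow> real^'n \<Rightarrow> real^'l" where
  "tensor_app A x y = (\<chi> i. \<Sum>j\<in>UNIV. \<Sum>k\<in>UNIV. A $ i $ j $ k * x $ j * y $ k)"

definition objective ::
    "real^'n^'m^'l \<Rightarrow> real^'l \<Rightarrow> (real^'m) \<times> (real^'n) \<Rightarrow> real" where
  "objective A b z = 1 / 2 * (norm (tensor_app A (fst z) (snd z) - b))\<^sup>2"

definition gradient :: "('a::real_inner \<Rightarrow> real) \<Rightarrow> 'a \<Rightarrow> 'a" where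
  "gradient f z = (THE D. GDERIV f z :> D)"

lemma gradient_eqI:
  assumes "GDERIV f z :> D"
  shows "gradient f z = D"
  unfolding gradient_def
proof (rule the_equality)
  fix D' assume "GDERIV f z :> D'"
  then have "(\<lambda>h. h \<bullet> D') = (\<lambda>h. h \<bullet> D)"
    using assms has_derivative_unique unfolding gderiv_def by blast
  then show "D' = D"
    by (metis inner_commute vector_eq_ldot)
qed (fact assms)

definition F1 :: "nat \<Rightarrow> (real^('m::{finite,linorder})) set" where
  "F1 s = {x. x \<noteq> 0 \<and> norm0 x \<le> s \<and> x $ first_nz x = 1}"

definition F2 :: "nat \<Rightarrow> (real^'n) set" where
  "F2 t = {y. norm0 y \<le> t}"

definition feasible :: "nat \<Rightarrow> nat \<Rightarrow> ((real^('m::{finite,linorder})) \<times> (real^'n)) set" where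
  "feasible s t = F1 s \<times> F2 t"

definition E_set :: "((real^('m::{finite,linorder})) \<times> (real^'n)) set" where
  "E_set = {(x, y). x \<noteq> 0 \<and> x $ first_nz x = 1}"

definition F_bar :: "nat \<Rightarrow> nat \<Rightarrow>
    (((real^('m::{finite,linorder})) \<times> (real^'n)) \<times> ((real^('m::{finite,linorder})) \<times> (real^'n))) set" where
  "F_bar s t = {(z, (u, v)).
     z \<in> E_set \<and> z \<bullet> (u, v) = 0 \<and>
     (\<Sum>i\<in>UNIV. u $ i) \<ge> real CARD('m) - real s \<and>
     (\<Sum>j\<in>UNIV. v $ j) \<ge> real CARD('n) - real t \<and>
     (\<forall>i. 0 \<le> coord (u, v) i \<and> coord (u, v) i \<le> 1)}"

definition bouligand_tangent :: "'a::real_inner set \<Rightarrow> 'a \<Rightarrow> 'a set" where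
  "bouligand_tangent S x = {d. \<exists>X r.
     (\<forall>k::nat. X k \<in> S) \<and> X \<longlonglongrightarrow> x \<and> (\<forall>k. r k \<ge> 0) \<and>
     (\<lambda>k. r k *\<^sub>R (X k - x)) \<longlonglongrightarrow> d}"

definition clarke_tangent :: "'a::real_inner set \<Rightarrow> 'a \<Rightarrow> 'a set" where
  "clarke_tangent S x = {d. \<forall>X r.
     (\<forall>k::nat. X k \<in> S) \<and> X \<longlonglongrightarrow> x \<and> (\<forall>k. r k \<ge> 0) \<and> r \<longlonglongrightarrow> 0 \<longrightarrow>
     (\<exists>Y. Y \<longlonglongrightarrow> d \<and> (\<forall>k. X k + r k *\<^sub>R Y k \<in> S))}"

datatype cone_kind = Bouligand | Clarke

fun tangent_cone :: "cone_kind \<Rightarrow> 'a::real_inner set \<Rightarrow> 'a \<Rightarrow> 'a set" where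
  "tangent_cone Bouligand S x = bouligand_tangent S x"
| "tangent_cone Clarke S x = clarke_tangent S x"

definition normal_cone :: "cone_kind \<Rightarrow> 'a::real_inner set \<Rightarrow> 'a \<Rightarrow> 'a set" where
  "normal_cone c S x = {d. \<forall>u\<in>tangent_cone c S x. d \<bullet> u \<le> 0}"

text \<open>
  M-stationarity for minimising \<open>f\<close> over \<open>feasible s t\<close>; the sparsity levels enter through
  \<open>F_bar s t\<close>.
\<close>
definition M_stationary :: "cone_kind \<Rightarrow> nat \<Rightarrow> nat \<Rightarrow>
    ((real^('m::{finite,linorder})) \<times> (real^'n) \<Rightarrow> real) \<Rightarrow>
    (real^('m::{finite,linorder})) \<times> (real^'n) \<Rightarrow> bool" where
  "M_stationary c s t f z \<longleftrightarrow>
     (\<exists>w \<mu>. (z, w) \<in> F_bar s t \<and>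
        - gradient f z - \<mu> \<in> normal_cone c E_set z \<and>
        (\<forall>i. coord z i \<noteq> 0 \<longrightarrow> coord \<mu> i = 0))"

end

theory Submission
  imports Defs
begin

text \<open>
  Membership in \<^term>\<open>E_set\<close> pins the first nonzero entry of \<open>x\<close> to \<open>1\<close>, a
  value isolated from \<open>0\<close>. Hence a point of \<^term>\<open>E_set\<close> at distance less than
  \<open>1\<close> from \<open>z = (x, y)\<close> has its first nonzero entry at the same index \<open>\<gamma>\<close> as
  \<open>x\<close> (\<open>first_nz_locally_constant\<close>): near \<open>z\<close>, the set is the affine subspace where the
  entries of \<open>x\<close> before \<open>\<gamma>\<close> vanish and the entry at \<open>\<gamma>\<close> is \<open>1\<close>. So the Bouligand and
  the Clarke tangent cones are both the direction space of that affine subspace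
  (\<open>tangent_cone_E_set\<close>), and the normal cone is its orthogonal complement, the vectors
  supported on the indices of \<open>x\<close> up to \<open>\<gamma>\<close> (\<open>normal_cone_E_set\<close>).

  M-stationarity thus asks for a \<open>\<mu>\<close> that vanishes on the support of \<open>z\<close> and cancels the
  gradient outside the indices up to \<open>\<gamma>\<close>. Off the support, \<open>\<mu>\<close> is free and can cancel
  anything; on the support, \<open>\<mu> = 0\<close> and the gradient itself has to vanish, except at \<open>\<gamma>\<close>, the
  only index of \<open>x\<close> up to \<open>\<gamma>\<close> that lies in the support. The auxiliary \<open>w\<close> is no obstruction: the
  indicator vector of the zero entries of a feasible \<open>z\<close> always qualifies.
\<close>

lemma first_nz_eqI:
  fixes x :: "real^('m::{finite,linorder})"
  assumes "x $ g \<noteq> 0" and "\<And>j. j < g \<Longrightarrow> x $ j = 0"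
  shows "first_nz x = g"
  unfolding first_nz_def supp_def
  using assms by (intro Min_eqI) (auto intro: leI)

lemma nth_first_nz:
  fixes x :: "real^('m::{finite,linorder})"
  assumes "x \<noteq> 0"
  shows "x $ first_nz x \<noteq> 0"
proof -
  have "supp x \<noteq> {}"
    using assms by (auto simp: supp_def vec_eq_iff)
  then have "Min (supp x) \<in> supp x"
    by (intro Min_in) auto
  then show ?thesis
    by (simp add: first_nz_def supp_def)
qed

lemma nth_before_first_nz:
  fixes x :: "real^('m::{finite,linorder})"
  assumes "j < first_nz x"
  shows "x $ j = 0"
proof (rule ccontr)
  assume "x $ j \<noteq> 0"
  then have "first_nz x \<le> j"
    by (simp add: first_nz_def supp_def)
  with assms show False by simp
qed

lemma E_setI:
  fixes z :: "(real^('m::{finite,linorder})) \<times> (real^'n)"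
  assumes "fst z $ g = 1" and "\<And>j. j < g \<Longrightarrow> fst z $ j = 0"
  shows "z \<in> E_set"
proof -
  have "first_nz (fst z) = g"
    using assms by (intro first_nz_eqI) auto
  then show ?thesis
    using assms(1) by (auto simp: E_set_def case_prod_unfold)
qed

text \<open>
  The value \<open>1\<close> at the first nonzero entry cannot be reached from an entry \<open>0\<close>, nor can it
  drop to \<open>0\<close>, by moving less than \<open>1\<close>; so that index moves neither forward nor backward.
\<close>
lemma first_nz_locally_constant:
  fixes x x' :: "real^('m::{finite,linorder})"
  assumes x: "x $ first_nz x = 1"
    and x': "x' \<noteq> 0" "x' $ first_nz x' = 1"
    and close: "dist x' x < 1"
  shows "first_nz x' = first_nz x"
proof -
  have entry: "\<bar>x' $ j - x $ j\<bar> < 1" for j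
    using close component_le_norm_cart[of "x' - x" j] by (simp add: dist_norm)
  have "\<not> first_nz x' < first_nz x"
    using entry[of "first_nz x'"] x'(2) nth_before_first_nz[of "first_nz x'" x] by auto
  moreover have "\<not> first_nz x < first_nz x'"
    using entry[of "first_nz x"] x nth_before_first_nz[of "first_nz x" x'] by auto
  ultimately show ?thesis by auto
qed

lemma E_set_locally_affine:
  fixes z z' :: "(real^('m::{finite,linorder})) \<times> (real^'n)"
  assumes "z \<in> E_set" and "z' \<in> E_set" and "dist z' z < 1"
    and "j \<le> first_nz (fst z)"
  shows "fst z' $ j = fst z $ j"
proof -
  have "dist (fst z') (fst z) < 1"
    using assms(3) dist_fst_le[of z' z] by simp
  then have same: "first_nz (fst z') = first_nz (fst z)"
    using assms(1,2) by (intro first_nz_locally_constant) (auto simp: E_set_def)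
  show ?thesis
  proof (cases "j = first_nz (fst z)")
    case True
    then show ?thesis
      using assms(1,2) same by (auto simp: E_set_def)
  next
    case False
    then have "j < first_nz (fst z)"
      using assms(4) by simp
    then show ?thesis
      using same nth_before_first_nz[of j "fst z"] nth_before_first_nz[of j "fst z'"] by simp
  qed
qed

text \<open>
  Testing a Clarke tangent direction on the constant sequence \<open>x\<close> with step sizes
  \<open>1 / (k + 1)\<close> yields points of \<open>S\<close> that converge to \<open>x\<close> along that direction.
\<close>
lemma clarke_subset_bouligand:
  assumes "x \<in> S"
  shows "clarke_tangent S x \<subseteq> bouligand_tangent S x"
proof
  fix d
  assume d: "d \<in> clarke_tangent S x"
  let ?r = "\<lambda>k. inverse (real (Suc k))"
  have "(\<forall>k::nat. x \<in> S) \<and> (\<lambda>k::nat. x) \<longlonglongrightarrow> x \<and> (\<forall>k. ?r k \<ge> 0) \<and> ?r \<longlonglongrightarrow> 0"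
    using assms LIMSEQ_inverse_real_of_nat by simp
  then obtain Y where Y: "Y \<longlonglongrightarrow> d" "\<And>k. x + ?r k *\<^sub>R Y k \<in> S"
    using d unfolding clarke_tangent_def mem_Collect_eq
    by (metis (no_types, lifting))
  have "(\<lambda>k. x + ?r k *\<^sub>R Y k) \<longlonglongrightarrow> x + 0 *\<^sub>R d"
    by (intro tendsto_intros LIMSEQ_inverse_real_of_nat Y(1))
  then have to_x: "(\<lambda>k. x + ?r k *\<^sub>R Y k) \<longlonglongrightarrow> x"
    by simp
  have "(\<lambda>k. real (Suc k) *\<^sub>R ((x + ?r k *\<^sub>R Y k) - x)) = Y"
    by (rule ext) simp
  then show "d \<in> bouligand_tangent S x"
    unfolding bouligand_tangent_def mem_Collect_eq
    using Y to_x
    by (intro exI[of _ "\<lambda>k. x + ?r k *\<^sub>R Y k"] exI[of _ "\<lambda>k. real (Suc k)"]) simp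
qed

lemma bouligand_tangent_E_set_subset:
  fixes z :: "(real^('m::{finite,linorder})) \<times> (real^'n)"
  assumes z: "z \<in> E_set"
  shows "bouligand_tangent E_set z \<subseteq> {d. \<forall>j\<le>first_nz (fst z). fst d $ j = 0}"
proof clarify
  fix d :: "(real^('m::{finite,linorder})) \<times> (real^'n)" and j
  assume d: "d \<in> bouligand_tangent E_set z" and j: "j \<le> first_nz (fst z)"
  obtain X r where X: "\<And>k::nat. X k \<in> E_set" "X \<longlonglongrightarrow> z"
    and lim: "(\<lambda>k. r k *\<^sub>R (X k - z)) \<longlonglongrightarrow> d"
    using d unfolding bouligand_tangent_def by auto
  have "\<forall>\<^sub>F k in sequentially. dist (X k) z < 1"
    using X(2) by (rule tendstoD) simp
  then have "\<forall>\<^sub>F k in sequentially. fst (r k *\<^sub>R (X k - z)) $ j = 0"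
  proof eventually_elim
    case (elim k)
    then have "fst (X k) $ j = fst z $ j"
      by (rule E_set_locally_affine[OF z X(1) _ j])
    then show ?case by simp
  qed
  then have "(\<lambda>k. fst (r k *\<^sub>R (X k - z)) $ j) \<longlonglongrightarrow> 0"
    by (rule tendsto_eventually)
  moreover have "(\<lambda>k. fst (r k *\<^sub>R (X k - z)) $ j) \<longlonglongrightarrow> fst d $ j"
    by (intro tendsto_vec_nth tendsto_fst lim)
  ultimately show "fst d $ j = 0"
    by (blast dest: LIMSEQ_unique)
qed

text \<open>
  The sequence in the definition of the Clarke cone may start far from \<open>z\<close>, where \<open>d\<close> may
  lead out of the set; there one stays in place. Close to \<open>z\<close>, the full step along \<open>d\<close> is
  possible because the set is affine.
\<close>
lemma clarke_tangent_E_set_supset: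
  fixes z :: "(real^('m::{finite,linorder})) \<times> (real^'n)"
  assumes z: "z \<in> E_set"
  shows "{d. \<forall>j\<le>first_nz (fst z). fst d $ j = 0} \<subseteq> clarke_tangent E_set z"
proof
  fix d :: "(real^('m::{finite,linorder})) \<times> (real^'n)"
  assume "d \<in> {d. \<forall>j\<le>first_nz (fst z). fst d $ j = 0}"
  then have d: "\<And>j. j \<le> first_nz (fst z) \<Longrightarrow> fst d $ j = 0"
    by simp
  have "\<exists>Y. Y \<longlonglongrightarrow> d \<and> (\<forall>k. X k + r k *\<^sub>R Y k \<in> E_set)"
    if X: "\<And>k::nat. X k \<in> E_set" "X \<longlonglongrightarrow> z"
    for X :: "nat \<Rightarrow> (real^('m::{finite,linorder})) \<times> (real^'n)" and r :: "nat \<Rightarrow> real"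
  proof (intro exI conjI allI)
    let ?Y = "\<lambda>k. if dist (X k) z < 1 then d else 0"
    have "\<forall>\<^sub>F k in sequentially. dist (X k) z < 1"
      using X(2) by (rule tendstoD) simp
    then have "\<forall>\<^sub>F k in sequentially. ?Y k = d"
      by eventually_elim simp
    then show "?Y \<longlonglongrightarrow> d"
      by (rule tendsto_eventually)
    fix k
    show "X k + r k *\<^sub>R ?Y k \<in> E_set"
    proof (cases "dist (X k) z < 1")
      case True
      have entry: "fst (X k + r k *\<^sub>R d) $ j = fst z $ j" if "j \<le> first_nz (fst z)" for j
        using E_set_locally_affine[OF z X(1) True that] d[OF that] by simp
      have "X k + r k *\<^sub>R d \<in> E_set"
      proof (rule E_setI)
        show "fst (X k + r k *\<^sub>R d) $ first_nz (fst z) = 1"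
          using entry[of "first_nz (fst z)"] z by (auto simp: E_set_def)
        show "fst (X k + r k *\<^sub>R d) $ j = 0" if "j < first_nz (fst z)" for j
          using entry[of j] that nth_before_first_nz[OF that] by simp
      qed
      with True show ?thesis by simp
    next
      case False
      then show ?thesis using X(1) by simp
    qed
  qed
  then show "d \<in> clarke_tangent E_set z"
    unfolding clarke_tangent_def by blast
qed

lemma tangent_cone_E_set:
  fixes z :: "(real^('m::{finite,linorder})) \<times> (real^'n)"
  assumes "z \<in> E_set"
  shows "tangent_cone c E_set z = {d. \<forall>j\<le>first_nz (fst z). fst d $ j = 0}"
  using bouligand_tangent_E_set_subset[OF assms] clarke_tangent_E_set_supset[OF assms]
    clarke_subset_bouligand[OF assms]
  by (cases c) (auto simp only: tangent_cone.simps)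

lemma normal_cone_E_set:
  fixes z :: "(real^('m::{finite,linorder})) \<times> (real^'n)"
  assumes "z \<in> E_set"
  shows "v \<in> normal_cone c E_set z \<longleftrightarrow>
    (\<forall>j>first_nz (fst z). fst v $ j = 0) \<and> snd v = 0"
proof
  assume "v \<in> normal_cone c E_set z"
  then have v: "v \<bullet> d \<le> 0" if "\<And>j. j \<le> first_nz (fst z) \<Longrightarrow> fst d $ j = 0" for d
  proof -
    have "d \<in> tangent_cone c E_set z"
      using that by (simp add: tangent_cone_E_set[OF assms])
    with \<open>v \<in> normal_cone c E_set z\<close> show ?thesis
      unfolding normal_cone_def by blast
  qed
  \<comment> \<open>Test against the coordinate components of \<open>v\<close> itself: each inner product is a square.\<close>
  have "fst v $ j = 0" if "first_nz (fst z) < j" for j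
  proof -
    have "v \<bullet> (axis j (fst v $ j), 0) \<le> 0"
      using that by (intro v) (auto simp: axis_def)
    then have "fst v $ j * fst v $ j \<le> 0"
      by (simp add: inner_prod_def inner_axis)
    then show ?thesis
      by (auto simp: mult_le_0_iff)
  qed
  moreover have "snd v = 0"
  proof -
    have "v \<bullet> (0, snd v) \<le> 0"
      by (intro v) simp
    then have "snd v \<bullet> snd v \<le> 0"
      by (simp add: inner_prod_def)
    then show ?thesis
      using inner_gt_zero_iff[of "snd v"] by linarith
  qed
  ultimately show "(\<forall>j>first_nz (fst z). fst v $ j = 0) \<and> snd v = 0"
    by blast
next
  assume v: "(\<forall>j>first_nz (fst z). fst v $ j = 0) \<and> snd v = 0"
  have "v \<bullet> d = 0" if "\<And>j. j \<le> first_nz (fst z) \<Longrightarrow> fst d $ j = 0" for d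
  proof -
    have "fst v $ j * fst d $ j = 0" for j
      using v that[of j] by (cases "j \<le> first_nz (fst z)") auto
    then have "fst v \<bullet> fst d = 0"
      unfolding inner_vec_def inner_real_def by (intro sum.neutral ballI)
    then show ?thesis
      using v by (simp add: inner_prod_def)
  qed
  then show "v \<in> normal_cone c E_set z"
    unfolding normal_cone_def tangent_cone_E_set[OF assms] by (intro CollectI ballI) simp
qed

lemma sum_zero_indicator:
  fixes x :: "real^'i"
  shows "(\<Sum>i\<in>UNIV. if x $ i = 0 then 1 else 0) = real CARD('i) - real (norm0 x)"
proof -
  have "{i. x $ i = 0} = UNIV - supp x"
    by (auto simp: supp_def)
  then have "real (card {i. x $ i = 0}) = real CARD('i) - real (norm0 x)"
    by (simp add: norm0_def card_Diff_subset card_mono of_nat_diff)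
  then show ?thesis
    by (simp add: sum.If_cases)
qed

lemma feasible_has_F_bar_witness:
  fixes x :: "real^('m::{finite,linorder})" and y :: "real^'n"
  assumes "(x, y) \<in> feasible s t"
  shows "\<exists>w. ((x, y), w) \<in> F_bar s t"
proof -
  define u :: "real^('m::{finite,linorder})" where "u = (\<chi> i. if x $ i = 0 then 1 else 0)"
  define v :: "real^'n" where "v = (\<chi> i. if y $ i = 0 then 1 else 0)"
  have "x \<bullet> u = 0" "y \<bullet> v = 0"
    by (auto simp: inner_vec_def u_def v_def intro!: sum.neutral)
  then have "(x, y) \<bullet> (u, v) = 0"
    by simp
  moreover have "0 \<le> coord (u, v) i \<and> coord (u, v) i \<le> 1" for i
    by (auto simp: coord_def u_def v_def split: sum.split)
  ultimately have "((x, y), (u, v)) \<in> F_bar s t"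
    using assms
    by (auto simp: F_bar_def E_set_def feasible_def F1_def F2_def u_def v_def sum_zero_indicator)
  then show ?thesis ..
qed

text \<open>
  Let \<open>\<gamma>\<close> be the index of the first nonzero entry of \<open>x\<close>. The multiplier absorbs the
  gradient off the support, the normal vector absorbs it at the indices of \<open>x\<close> up to \<open>\<gamma>\<close>;
  since the entries of \<open>x\<close> before \<open>\<gamma>\<close> are zero, the indices that neither of them reaches
  are those of the support other than \<open>\<gamma>\<close>.
\<close>
lemma M_stationary_iff_gradient_on_support:
  fixes x :: "real^('m::{finite,linorder})" and y :: "real^'n"
  assumes feas: "(x, y) \<in> feasible s t"
  shows "M_stationary c s t f (x, y) \<longleftrightarrow>
    (\<forall>i \<in> pair_supp (x, y) - {Inl (first_nz x)}. coord (gradient f (x, y)) i = 0)"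
proof -
  let ?g = "gradient f (x, y)"
  have E: "(x, y) \<in> E_set"
    using feas by (auto simp: feasible_def F1_def E_set_def)
  note normal = normal_cone_E_set[OF E, unfolded fst_conv]
  show ?thesis
  proof
    assume "M_stationary c s t f (x, y)"
    then obtain \<mu> where N: "- ?g - \<mu> \<in> normal_cone c E_set (x, y)"
      and \<mu>: "\<And>i. coord (x, y) i \<noteq> 0 \<Longrightarrow> coord \<mu> i = 0"
      unfolding M_stationary_def by blast
    show "\<forall>i \<in> pair_supp (x, y) - {Inl (first_nz x)}. coord ?g i = 0"
    proof
      fix i
      assume "i \<in> pair_supp (x, y) - {Inl (first_nz x)}"
      then have nz: "coord (x, y) i \<noteq> 0" and ne: "i \<noteq> Inl (first_nz x)"
        by (auto simp: pair_supp_def)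
      show "coord ?g i = 0"
      proof (cases i)
        case (Inl j)
        then have "first_nz x < j"
          using nz ne nth_before_first_nz[of j x] by (cases j "first_nz x" rule: linorder_cases) (auto simp: coord_def)
        then have "fst (- ?g - \<mu>) $ j = 0"
          using N normal by blast
        then show ?thesis
          using \<mu>[OF nz] Inl by (simp add: coord_def)
      next
        case (Inr k)
        have "snd (- ?g - \<mu>) $ k = 0"
          using N normal by simp
        then show ?thesis
          using \<mu>[OF nz] Inr by (simp add: coord_def)
      qed
    qed
  next
    assume g: "\<forall>i \<in> pair_supp (x, y) - {Inl (first_nz x)}. coord ?g i = 0"
    have g1: "fst ?g $ j = 0" if "x $ j \<noteq> 0" "first_nz x < j" for j
      using bspec[OF g, of "Inl j"] that by (auto simp: pair_supp_def coord_def)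
    have g2: "snd ?g $ k = 0" if "y $ k \<noteq> 0" for k
      using bspec[OF g, of "Inr k"] that by (auto simp: pair_supp_def coord_def)
    define \<mu> :: "(real^('m::{finite,linorder})) \<times> (real^'n)" where
      "\<mu> = (\<chi> j. if x $ j = 0 then - fst ?g $ j else 0, \<chi> k. if y $ k = 0 then - snd ?g $ k else 0)"
    have "- ?g - \<mu> \<in> normal_cone c E_set (x, y)"
      unfolding normal using g1 g2 by (auto simp: \<mu>_def vec_eq_iff)
    moreover have "\<forall>i. coord (x, y) i \<noteq> 0 \<longrightarrow> coord \<mu> i = 0"
      by (auto simp: coord_def \<mu>_def split: sum.split)
    ultimately show "M_stationary c s t f (x, y)"
      unfolding M_stationary_def using feasible_has_F_bar_witness[OF feas] by blast
  qed
qed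

theorem theorem3p20:
  fixes A :: "real^'n^('m::{finite,linorder})^'l"
    and b :: "real^'l"
    and s t :: nat
    and x :: "real^('m::{finite,linorder})" and y :: "real^'n"
    and c :: cone_kind
  assumes "0 < s" and "s < CARD('m)"
    and "0 < t" and "t < CARD('n)"
    and "(x, y) \<in> feasible s t"
  shows "M_stationary c s t (objective A b) (x, y) \<longleftrightarrow>
    (\<forall>i \<in> pair_supp (x, y) - {Inl (first_nz x)}. coord (gradient (objective A b) (x, y)) i = 0)"
  using assms(5) by (rule M_stationary_iff_gradient_on_support)

end
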